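(* Let $\mu$ be a probability measure on $\mathbb{R}^d$ ($d\ge 1$) with finite moments of all orders, and let $(\Omega_n)_{n\in\mathbb{N}}$ be the associated sequence of positive operators (Jacobi sequence), $\Omega_n\in\mathcal{L}\big((\mathbb{C}^d)^{\hat\otimes n}\big)$. Then there exists $n_0\in\mathbb{N}^*$ such that $\Omega_n=0$ for all $n\ge n_0$ if and only if $\mu$ is atomic with a finite number of atoms, i.e. $\mu=\sum_{i\in I}a_i\delta_{x_i}$ for some finite set $I$, points $x_i\in\mathbb{R}^d$ and weights $a_i>0$ with $\sum_{i\in I}a_i=1$.
   Context: $\mathbb{N}=\{0,1,2,\dots\}$, $\mathbb{N}^*=\{1,2,\dots\}$. Let $\mathcal{P}=\mathbb{C}[X_1,\dots,X_d]$, let $\mathcal{P}_{n]}$ be the subspace of polynomials of degree at most $n$, and $\mathcal{P}_{-1]}=\{0\}$. The measure $\mu$ gives the pre-scalar product (possibly degenerate) $\langle P,Q\rangle_\mu=\int_{\mathbb{R}^d}\overline{P(x)}\,Q(x)\,d\mu(x)$ on $\mathcal{P}$. A subspace $\mathcal{P}_n\subset\mathcal{P}_{n]}$ is called monic of degree $n$ if $\mathcal{P}_{n]}$ is the vector space direct sum of $\mathcal{P}_{n-1]}$ and $\mathcal{P}_n$, and $\mathcal{P}_n$ has a linear basis each of whose elements has as highest order term a nonzero multiple of a monomial of degree $n$. Fix a direct sum decomposition $\mathcal{P}=\bigoplus_{n\in\mathbb{N}}\mathcal{P}_n$ with each $\mathcal{P}_n$ monic of degree $n$, $\mathcal{P}_m\perp\mathcal{P}_n$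 for $\langle\cdot,\cdot\rangle_\mu$ when $m\ne n$, and $\mathcal{P}_{n]}=\bigoplus_{h=0}^n\mathcal{P}_h$ (such a decomposition always exists). Let $P_n:\mathcal{P}\to\mathcal{P}_n$ be the projection along this decomposition. For $v=(v_1,\dots,v_d)\in\mathbb{C}^d$ let $X_v=\sum_j v_jX_j$ (as a multiplication operator) and define the creation operator $a^+_v=\sum_{n\in\mathbb{N}}P_{n+1}X_vP_n$ on $\mathcal{P}$; these operators commute with each other. $(\mathbb{C}^d)^{\hat\otimes n}$ denotes the space of symmetric tensors of order $n$, $v_n\hat\otimes\cdots\hat\otimes v_1$ the symmetrization of $v_n\otimes\cdots\otimes v_1$, and the tensor scalar product on $(\mathbb{C}^d)^{\hat\otimes n}$ is the one with $\langle u^{\otimes n},v^{\otimes n}\rangle=\langle u,v\rangle_{\mathbb{C}^d}^n$, where $\langle\cdot,\cdot\rangle_{\mathbb{C}^d}$ is the standard scalar product. The linear isomorphism $U_n:(\mathbb{C}^d)^{\hat\otimes n}\to\mathcal{P}_n$ is determined by $U_n(v_n\hat\otimes\cdots\hat\otimes v_1)=a^+_{v_n}\cdots a^+_{v_1}1$, with $U_0(z)=z\cdot 1$. The operator $\Omega_n$ is the linear operator on $(\mathbb{C}^d)^{\hat\otimes n}$ determined by $\langle\xi,\Omega_n\eta\rangle_{(\mathbb{C}^d)^{\hat\otimes n}}=\langle U_n\xi,U_n\eta\rangle_\mu$ for all $\xi,\eta\in(\mathbb{C}^d)^{\hat\otimes n}$. *)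

theory Defs
  imports
    "HOL-Probability.Probability"
    "HOL-Library.Poly_Mapping"
    "HOL-Library.Function_Algebras"
    "HOL-Library.FuncSet"
    "HOL-Combinatorics.Permutations"
begin

section \<open>Complex polynomials in finitely many indeterminates\<close>

text \<open>
  The index type \<open>'d\<close> plays the role of \<open>{1..d}\<close>; thus \<open>d = CARD('d) \<ge> 1\<close>.  A monomial is its
  exponent vector, and the ring structure on \<open>'d mpoly\<close> is the convolution product of
  \<^theory>\<open>HOL-Library.Poly_Mapping\<close>.
\<close>

type_synonym 'd mpoly = "('d \<Rightarrow>\<^sub>0 nat) \<Rightarrow>\<^sub>0 complex"

definition smult_poly :: "complex \<Rightarrow> 'd mpoly \<Rightarrow> 'd mpoly" where
  "smult_poly c p = Poly_Mapping.single 0 c * p"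

interpretation mpoly: vector_space smult_poly
proof
  fix a b :: complex and x y :: "'d mpoly"
  show "smult_poly a (x + y) = smult_poly a x + smult_poly a y"
    by (simp add: smult_poly_def distrib_left)
  show "smult_poly (a + b) x = smult_poly a x + smult_poly b x"
    by (simp add: smult_poly_def single_add distrib_right)
  show "smult_poly a (smult_poly b x) = smult_poly (a * b) x"
    by (simp add: smult_poly_def mult.assoc[symmetric] mult_single)
  show "smult_poly 1 x = x"
    by (simp add: smult_poly_def)
qed

definition eval_poly :: "'d::finite mpoly \<Rightarrow> complex ^ 'd \<Rightarrow> complex" where
  "eval_poly p z =
     (\<Sum>m\<in>Poly_Mapping.keys p. Poly_Mapping.lookup p m * (\<Prod>j\<in>UNIV. (z $ j) ^ Poly_Mapping.lookup m j))"

definition monom_degree :: "('d::finite \<Rightarrow>\<^sub>0 nat) \<Rightarrow> nat" where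
  "monom_degree m = (\<Sum>j\<in>UNIV. Poly_Mapping.lookup m j)"

text \<open>The bound is an integer so that \<open>polys_upto (-1) = {0}\<close>.\<close>

definition polys_upto :: "int \<Rightarrow> 'd::finite mpoly set" where
  "polys_upto k = {p. \<forall>m\<in>Poly_Mapping.keys p. int (monom_degree m) \<le> k}"

lemma polys_upto_minus_one: "polys_upto (-1) = {0}"
  by (auto simp: polys_upto_def)

definition indet :: "'d \<Rightarrow> 'd mpoly" where
  "indet j = Poly_Mapping.single (Poly_Mapping.single j 1) 1"

definition X_of :: "complex ^ 'd \<Rightarrow> 'd::finite mpoly" where
  "X_of v = (\<Sum>j\<in>UNIV. smult_poly (v $ j) (indet j))"


section \<open>Monic orthogonal decompositions\<close>

definition finite_moments :: "(real ^ 'd::finite) measure \<Rightarrow> bool" where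
  "finite_moments \<mu> \<longleftrightarrow>
     (\<forall>\<alpha> :: 'd \<Rightarrow> nat. integrable \<mu> (\<lambda>x. \<Prod>j\<in>UNIV. (x $ j) ^ \<alpha> j))"

definition poly_inner :: "(real ^ 'd::finite) measure \<Rightarrow> 'd mpoly \<Rightarrow> 'd mpoly \<Rightarrow> complex" where
  "poly_inner \<mu> p q =
     (\<integral>x. cnj (eval_poly p (\<chi> j. complex_of_real (x $ j)))
            * eval_poly q (\<chi> j. complex_of_real (x $ j)) \<partial>\<mu>)"

definition monic_subspace :: "nat \<Rightarrow> 'd::finite mpoly set \<Rightarrow> bool" where
  "monic_subspace n W \<longleftrightarrow>
     mpoly.subspace W \<and> W \<subseteq> polys_upto (int n) \<and>
     polys_upto (int n) = {q + r | q r. q \<in> polys_upto (int n - 1) \<and> r \<in> W} \<and>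
     polys_upto (int n - 1) \<inter> W = {0} \<and>
     (\<exists>B. mpoly.independent B \<and> mpoly.span B = W \<and>
        (\<forall>b\<in>B. \<exists>c m. c \<noteq> 0 \<and> monom_degree m = n \<and>
             b - Poly_Mapping.single m c \<in> polys_upto (int n - 1)))"

definition is_components :: "nat set \<Rightarrow> (nat \<Rightarrow> 'd mpoly set) \<Rightarrow> 'd mpoly \<Rightarrow> (nat \<Rightarrow> 'd mpoly) \<Rightarrow> bool" where
  "is_components I V p f \<longleftrightarrow>
     (\<forall>i\<in>I. f i \<in> V i) \<and> (\<forall>i. i \<notin> I \<longrightarrow> f i = 0) \<and> finite {i. f i \<noteq> 0} \<and>
     p = sum f {i. f i \<noteq> 0}"

definition direct_sum :: "nat set \<Rightarrow> (nat \<Rightarrow> 'd mpoly set) \<Rightarrow> 'd mpoly set \<Rightarrow> bool" where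
  "direct_sum I V W \<longleftrightarrow>
     W = {p. \<exists>f. is_components I V p f} \<and> (\<forall>p\<in>W. \<exists>!f. is_components I V p f)"

definition orthogonal_decomposition ::
    "(real ^ 'd::finite) measure \<Rightarrow> (nat \<Rightarrow> 'd mpoly set) \<Rightarrow> bool" where
  "orthogonal_decomposition \<mu> V \<longleftrightarrow>
     (\<forall>n. monic_subspace n (V n)) \<and>
     direct_sum UNIV V UNIV \<and>
     (\<forall>n. direct_sum {..n} V (polys_upto (int n))) \<and>
     (\<forall>m n. m \<noteq> n \<longrightarrow> (\<forall>p\<in>V m. \<forall>q\<in>V n. poly_inner \<mu> p q = 0))"

definition decomp_proj :: "(nat \<Rightarrow> 'd mpoly set) \<Rightarrow> nat \<Rightarrow> 'd mpoly \<Rightarrow> 'd mpoly" where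
  "decomp_proj V n p = (THE f. is_components UNIV V p f) n"

text \<open>\<^const>\<open>Sum_any\<close> sums the nonzero summands, of which there are finitely many for each \<open>p\<close>.\<close>

definition creation :: "(nat \<Rightarrow> 'd::finite mpoly set) \<Rightarrow> complex ^ 'd \<Rightarrow> 'd mpoly \<Rightarrow> 'd mpoly" where
  "creation V v p = Sum_any (\<lambda>n. decomp_proj V (Suc n) (X_of v * decomp_proj V n p))"


section \<open>Symmetric tensors\<close>

text \<open>
  A tensor of order \<open>n\<close> over \<open>complex ^ 'd\<close> is given by its coordinates with respect to the
  basis of all \<open>e\<^bsub>i1\<^esub> \<otimes> \<dots> \<otimes> e\<^bsub>in\<^esub>\<close>, indexed by the lists \<open>[i1, \<dots>, in]\<close> of length \<open>n\<close>;
  the coordinate function is zero on lists of any other length.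
\<close>

type_synonym 'd tensor = "'d list \<Rightarrow> complex"

definition smult_tensor :: "complex \<Rightarrow> 'd tensor \<Rightarrow> 'd tensor" where
  "smult_tensor c \<xi> = (\<lambda>is. c * \<xi> is)"

definition sym_tensors :: "nat \<Rightarrow> 'd tensor set" where
  "sym_tensors n =
     {\<xi>. (\<forall>is. length is \<noteq> n \<longrightarrow> \<xi> is = 0) \<and>
          (\<forall>\<sigma> is. length is = n \<and> \<sigma> permutes {..<n} \<longrightarrow> \<xi> (permute_list \<sigma> is) = \<xi> is)}"

definition pure_tensor :: "(complex ^ 'd) list \<Rightarrow> 'd tensor" where
  "pure_tensor vs =
     (\<lambda>is. if length is = length vs then \<Prod>k<length vs. (vs ! k) $ (is ! k) else 0)"

definition sym_product :: "(complex ^ 'd) list \<Rightarrow> 'd tensor" where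
  "sym_product vs =
     (\<lambda>is. (1 / fact (length vs)) *
        (\<Sum>\<sigma> | \<sigma> permutes {..<length vs}. pure_tensor (permute_list \<sigma> vs) is))"

definition tensor_inner :: "nat \<Rightarrow> 'd::finite tensor \<Rightarrow> 'd tensor \<Rightarrow> complex" where
  "tensor_inner n \<xi> \<eta> = (\<Sum>is | length is = n. cnj (\<xi> is) * \<eta> is)"

lemma pure_tensor_Cons: "pure_tensor (v # vs) (i # is) = v $ i * pure_tensor vs is"
  by (simp add: pure_tensor_def prod.lessThan_Suc_shift del: prod.lessThan_Suc)

lemma tensor_inner_power:
  fixes u v :: "complex ^ 'd::finite"
  shows "tensor_inner n (pure_tensor (replicate n u)) (pure_tensor (replicate n v)) =
    (\<Sum>j\<in>UNIV. cnj (u $ j) * v $ j) ^ n"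
proof (induction n)
  case 0
  then show ?case by (simp add: tensor_inner_def pure_tensor_def)
next
  case (Suc n)
  have S: "{is :: 'd list. length is = Suc n} = (\<lambda>(i, is). i # is) ` (UNIV \<times> {is. length is = n})"
    by (auto simp: length_Suc_conv image_iff)
  have "tensor_inner (Suc n) (pure_tensor (replicate (Suc n) u)) (pure_tensor (replicate (Suc n) v)) =
    (\<Sum>(i, is)\<in>UNIV \<times> {is. length is = n}. (cnj (u $ i) * v $ i) *
       (cnj (pure_tensor (replicate n u) is) * pure_tensor (replicate n v) is))"
    unfolding tensor_inner_def S
    by (subst sum.reindex)
       (auto simp: inj_on_def pure_tensor_Cons mult_ac intro!: sum.cong)
  also have "\<dots> = (\<Sum>j\<in>UNIV. cnj (u $ j) * v $ j) *
      tensor_inner n (pure_tensor (replicate n u)) (pure_tensor (replicate n v))"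
    by (simp add: tensor_inner_def sum_product sum.cartesian_product)
  finally show ?case using Suc by simp
qed


section \<open>The operators \<open>U\<^sub>n\<close> and the Jacobi sequence\<close>

text \<open>
  Both operators have domain \<^term>\<open>sym_tensors n\<close>.  The definite descriptions are made unambiguous
  by taking the functions to be \<^const>\<open>undefined\<close> outside this domain.
\<close>

definition is_linear_on ::
    "'d tensor set \<Rightarrow> (complex \<Rightarrow> 'b::ab_group_add \<Rightarrow> 'b) \<Rightarrow> ('d tensor \<Rightarrow> 'b) \<Rightarrow> bool" where
  "is_linear_on S sm F \<longleftrightarrow>
     (\<forall>\<xi>\<in>S. \<forall>\<eta>\<in>S. F (\<xi> + \<eta>) = F \<xi> + F \<eta>) \<and>
     (\<forall>c. \<forall>\<xi>\<in>S. F (smult_tensor c \<xi>) = sm c (F \<xi>))"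

definition U_op :: "(nat \<Rightarrow> 'd::finite mpoly set) \<Rightarrow> nat \<Rightarrow> 'd tensor \<Rightarrow> 'd mpoly" where
  "U_op V n = (THE U.
     U \<in> sym_tensors n \<rightarrow>\<^sub>E V n \<and>
     is_linear_on (sym_tensors n) smult_poly U \<and>
     (\<forall>vs. length vs = n \<longrightarrow> U (sym_product vs) = foldr (creation V) vs 1))"

definition jacobi_op ::
    "(real ^ 'd::finite) measure \<Rightarrow> (nat \<Rightarrow> 'd mpoly set) \<Rightarrow> nat \<Rightarrow> 'd tensor \<Rightarrow> 'd tensor" where
  "jacobi_op \<mu> V n = (THE \<Omega>.
     \<Omega> \<in> sym_tensors n \<rightarrow>\<^sub>E sym_tensors n \<and>
     is_linear_on (sym_tensors n) smult_tensor \<Omega> \<and>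
     (\<forall>\<xi>\<in>sym_tensors n. \<forall>\<eta>\<in>sym_tensors n.
        tensor_inner n \<xi> (\<Omega> \<eta>) = poly_inner \<mu> (U_op V n \<xi>) (U_op V n \<eta>)))"

end

theory Submission
  imports Defs
begin

text \<open>
  The degree \<open>n\<close> part of the Jacobi sequence is the Gram operator of the orthogonal polynomials of
  degree \<open>n\<close>, so both sides of the equivalence say that only finitely many degrees carry orthogonal
  polynomials that are nonzero in \<open>L\<^sup>2(\<mu>)\<close>.

  Modulo lower degree, a product of creation operators applied to 1 is just the product of the
  corresponding linear forms (\<open>creations_eq_proj\<close>). Therefore \<open>U\<^sub>n\<close> sends a symmetric tensor to the
  projection onto \<open>V n\<close> of the homogeneous polynomial with these coefficients (\<open>U_op_eq\<close>), and its
  values span \<open>V n\<close> (\<open>V_spanned_by_U\<close>). Since \<open>\<langle>\<xi>, \<Omega>\<^sub>n \<eta>\<rangle> = \<langle>U\<^sub>n \<xi>, U\<^sub>n \<eta>\<rangle>\<close>, the operator \<open>\<Omega>\<^sub>n\<close> is zero exactly if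
  every polynomial in \<open>V n\<close> vanishes \<open>\<mu>\<close>-almost everywhere (\<open>jacobi_op_zero_iff\<close>).

  Suppose this happens for all large \<open>n\<close>. Then every polynomial agrees almost everywhere with one of
  bounded degree. The powers of each coordinate function thus span a finite-dimensional space modulo
  null functions, so each coordinate is almost everywhere a root of a fixed nonzero polynomial in one
  variable. Almost every point then lies in a finite grid, and \<open>\<mu>\<close> is a finite sum of atoms.

  Conversely, if \<open>\<mu>\<close> lives on finitely many points and \<open>n\<close> exceeds their number, interpolation
  replaces \<open>p \<in> V n\<close> by a polynomial of degree less than \<open>n\<close> with the same values on the atoms. As
  \<open>p\<close> is orthogonal to all of these, \<open>\<langle>p, p\<rangle> = 0\<close>.
\<close>

section \<open>Evaluation and degree of polynomials\<close>

abbreviation coeff_of :: "'d mpoly \<Rightarrow> ('d \<Rightarrow>\<^sub>0 nat) \<Rightarrow> complex" where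
  "coeff_of \<equiv> Poly_Mapping.lookup"

definition monom_value :: "complex ^ 'd \<Rightarrow> ('d::finite \<Rightarrow>\<^sub>0 nat) \<Rightarrow> complex" where
  "monom_value z m = (\<Prod>j\<in>UNIV. (z $ j) ^ Poly_Mapping.lookup m j)"

lemma monom_value_add: "monom_value z (m + m') = monom_value z m * monom_value z m'"
  by (simp add: monom_value_def lookup_add power_add prod.distrib)

lemma eval_poly_superset:
  assumes "finite A" "Poly_Mapping.keys p \<subseteq> A"
  shows "eval_poly p z = (\<Sum>m\<in>A. coeff_of p m * monom_value z m)"
  unfolding eval_poly_def monom_value_def
  using assms by (intro sum.mono_neutral_left) (auto simp: in_keys_iff)

lemma eval_poly_add [simp]: "eval_poly (p + q) z = eval_poly p z + eval_poly q z"
proof -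
  let ?A = "Poly_Mapping.keys p \<union> Poly_Mapping.keys q"
  have "Poly_Mapping.keys (p + q) \<subseteq> ?A" by (rule keys_add)
  then show ?thesis
    by (simp add: eval_poly_superset[of ?A] lookup_add algebra_simps sum.distrib)
qed

lemma eval_poly_zero [simp]: "eval_poly 0 z = 0"
  by (simp add: eval_poly_def)

lemma eval_poly_single: "eval_poly (Poly_Mapping.single m c) z = c * monom_value z m"
  by (simp add: eval_poly_superset[of "{m}"])

lemma eval_poly_sum: "eval_poly (sum f A) z = (\<Sum>a\<in>A. eval_poly (f a) z)"
  by (induction A rule: infinite_finite_induct) auto

lemma poly_eq_sum_monomials: "p = (\<Sum>m\<in>Poly_Mapping.keys p. Poly_Mapping.single m (coeff_of p m))"
proof (rule poly_mapping_eqI)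
  fix k
  show "coeff_of p k
      = coeff_of (\<Sum>m\<in>Poly_Mapping.keys p. Poly_Mapping.single m (coeff_of p m)) k"
    by (simp add: lookup_sum lookup_single when_def in_keys_iff)
qed

lemma eval_poly_mult [simp]: "eval_poly (p * q) z = eval_poly p z * eval_poly q z"
proof -
  let ?s = "\<lambda>p m. Poly_Mapping.single m (coeff_of p m)"
  have "p * q = (\<Sum>m\<in>Poly_Mapping.keys p. \<Sum>m'\<in>Poly_Mapping.keys q. ?s p m * ?s q m')"
    unfolding sum_product[symmetric] poly_eq_sum_monomials[symmetric] ..
  then have "eval_poly (p * q) z =
      eval_poly (\<Sum>m\<in>Poly_Mapping.keys p. \<Sum>m'\<in>Poly_Mapping.keys q. ?s p m * ?s q m') z"
    by (rule arg_cong)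
  also have "\<dots> = (\<Sum>m\<in>Poly_Mapping.keys p. coeff_of p m * monom_value z m) *
      (\<Sum>m\<in>Poly_Mapping.keys q. coeff_of q m * monom_value z m)"
    unfolding sum_product
    by (simp add: eval_poly_sum mult_single eval_poly_single monom_value_add mult_ac)
  finally show ?thesis
    by (simp add: eval_poly_superset[symmetric])
qed

lemma eval_poly_smult [simp]: "eval_poly (smult_poly c p) z = c * eval_poly p z"
  by (simp add: smult_poly_def eval_poly_single monom_value_def)

lemma eval_poly_one [simp]: "eval_poly 1 z = 1"
  using eval_poly_single[of 0 1 z] by (simp add: monom_value_def)

lemma monom_value_single: "monom_value z (Poly_Mapping.single j k) = (z $ j) ^ k"
  unfolding monom_value_def lookup_single when_def
  by (subst prod.remove[of _ j]) (auto intro!: prod.neutral)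

lemma eval_poly_indet [simp]: "eval_poly (indet j) z = z $ j"
  by (simp add: indet_def eval_poly_single monom_value_single)

lemma eval_poly_diff [simp]: "eval_poly (p - q) z = eval_poly p z - eval_poly q z"
  using eval_poly_add[of "p - q" q z] by (simp del: eval_poly_add)

lemma smult_poly_mult_left: "smult_poly c p * q = smult_poly c (p * q)"
  by (simp add: smult_poly_def mult.assoc)

lemma smult_poly_mult_right: "p * smult_poly c q = smult_poly c (p * q)"
  by (simp add: smult_poly_def mult_ac)

lemma smult_poly_single: "smult_poly c (Poly_Mapping.single m a) = Poly_Mapping.single m (c * a)"
  by (simp add: smult_poly_def mult_single)

lemma monom_degree_add: "monom_degree (m + m') = monom_degree m + monom_degree m'"
  by (simp add: monom_degree_def lookup_add sum.distrib)

lemma monom_degree_single: "monom_degree (Poly_Mapping.single j k) = k"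
  unfolding monom_degree_def lookup_single when_def by simp

lemma monom_degree_zero [simp]: "monom_degree 0 = 0"
  by (simp add: monom_degree_def)

lemma polys_upto_mult:
  assumes "p \<in> polys_upto k" "q \<in> polys_upto l"
  shows "p * q \<in> polys_upto (k + l)"
  unfolding polys_upto_def
proof (intro CollectI ballI)
  fix m assume "m \<in> Poly_Mapping.keys (p * q)"
  then obtain a b where "m = a + b" "a \<in> Poly_Mapping.keys p" "b \<in> Poly_Mapping.keys q"
    using keys_mult by blast
  then show "int (monom_degree m) \<le> k + l"
    using assms by (auto simp: polys_upto_def monom_degree_add add_mono)
qed

lemma single_in_polys_upto: "int (monom_degree m) \<le> k \<Longrightarrow> Poly_Mapping.single m c \<in> polys_upto k"
  by (simp add: polys_upto_def)

lemma subspace_polys_upto: "mpoly.subspace (polys_upto k)"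
proof (rule mpoly.subspaceI)
  show "0 \<in> polys_upto k" by (simp add: polys_upto_def)
next
  fix p q :: "'a mpoly" assume "p \<in> polys_upto k" "q \<in> polys_upto k"
  then show "p + q \<in> polys_upto k" using keys_add[of p q] by (auto simp: polys_upto_def)
next
  fix c and p :: "'a mpoly" assume "p \<in> polys_upto k"
  then show "smult_poly c p \<in> polys_upto k"
    using polys_upto_mult[of "Poly_Mapping.single 0 c" 0 p k]
    by (simp add: smult_poly_def single_in_polys_upto)
qed

lemma polys_upto_mono: "k \<le> l \<Longrightarrow> polys_upto k \<subseteq> polys_upto l"
  by (force simp: polys_upto_def)

lemma indet_in_polys_upto: "indet j \<in> polys_upto 1"
  by (simp add: indet_def single_in_polys_upto monom_degree_single)

lemma one_in_polys_upto: "1 \<in> polys_upto 0"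
  using single_in_polys_upto[of 0 0 1] by simp

lemma X_of_in_polys_upto: "X_of v \<in> polys_upto 1"
  unfolding X_of_def
  by (intro mpoly.subspace_sum mpoly.subspace_scale subspace_polys_upto indet_in_polys_upto)

lemma prod_X_of_in_polys_upto: "prod_list (map X_of vs) \<in> polys_upto (int (length vs))"
proof (induction vs)
  case (Cons v vs)
  then show ?case using polys_upto_mult[OF X_of_in_polys_upto Cons] by (simp add: add.commute)
qed (simp add: one_in_polys_upto)

lemma poly_upto_exists_nat: "\<exists>n. p \<in> polys_upto (int n)"
proof
  show "p \<in> polys_upto (int (Max (monom_degree ` Poly_Mapping.keys p)))"
    by (auto simp: polys_upto_def)
qed

lemma X_of_axis: "X_of (axis i 1) = indet i"
proof -
  have "X_of (axis i 1) = (\<Sum>j\<in>UNIV. if j = i then indet i else 0)"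
    unfolding X_of_def by (intro sum.cong) (auto simp: axis_def)
  then show ?thesis by simp
qed

text \<open>
  Translates exponent vectors, which index the coefficients of a polynomial, into lists of
  variables, which index the coordinates of a tensor.
\<close>

lemma monomial_as_product_of_indets:
  "\<exists>is. length is = monom_degree m \<and> Poly_Mapping.single m 1 = prod_list (map indet is)"
proof (induction "monom_degree m" arbitrary: m)
  case 0
  then have "m = 0" by (intro poly_mapping_eqI) (auto simp: monom_degree_def)
  then show ?case using 0 by (intro exI[of _ "[]"]) simp
next
  case (Suc n)
  then obtain j where j: "Poly_Mapping.lookup m j \<noteq> 0"
    unfolding monom_degree_def using sum.neutral[of UNIV "Poly_Mapping.lookup m"] by fastforce
  define m' where "m' = m - Poly_Mapping.single j 1"
  have m: "m = Poly_Mapping.single j 1 + m'"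
    using j unfolding m'_def
    by (intro poly_mapping_eqI) (auto simp: lookup_add lookup_minus lookup_single when_def)
  then have "n = monom_degree m'"
    using Suc(2) by (simp add: monom_degree_add monom_degree_single)
  then obtain js where js: "length js = n"
      "Poly_Mapping.single m' (1::complex) = prod_list (map indet js)"
    using Suc(1)[of m'] by auto
  have "Poly_Mapping.single m (1::complex) = indet j * Poly_Mapping.single m' 1"
    by (subst m) (simp add: indet_def mult_single)
  then show ?case using js Suc(2)
    by (intro exI[of _ "j # js"]) simp
qed

section \<open>Projections of an orthogonal decomposition\<close>

text \<open>
  Letting the sum run over any finite set that contains the support makes it possible to add two
  families of components over a common index set; this is how the projections turn out linear.
\<close>

lemma is_components_iff:
  "is_components UNIV V p f \<longleftrightarrow>
    (\<forall>i. f i \<in> V i) \<and> (\<exists>A. finite A \<and> {i. f i \<noteq> 0} \<subseteq> A \<and> p = sum f A)"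
proof
  show "is_components UNIV V p f \<Longrightarrow>
      (\<forall>i. f i \<in> V i) \<and> (\<exists>A. finite A \<and> {i. f i \<noteq> 0} \<subseteq> A \<and> p = sum f A)"
    unfolding is_components_def by (intro conjI exI[of _ "{i. f i \<noteq> 0}"]) simp_all
next
  assume "(\<forall>i. f i \<in> V i) \<and> (\<exists>A. finite A \<and> {i. f i \<noteq> 0} \<subseteq> A \<and> p = sum f A)"
  then obtain A where A: "\<forall>i. f i \<in> V i" "finite A" "{i. f i \<noteq> 0} \<subseteq> A" "p = sum f A" by blast
  have "sum f A = sum f {i. f i \<noteq> 0}"
    using A by (intro sum.mono_neutral_right) auto
  then show "is_components UNIV V p f"
    using A finite_subset[OF A(3,2)] by (simp add: is_components_def)
qed

locale monic_decomposition =
  fixes \<mu> :: "(real ^ 'd::finite) measure" and V :: "nat \<Rightarrow> 'd mpoly set"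
  assumes decomposition: "orthogonal_decomposition \<mu> V"
begin

abbreviation "P \<equiv> decomp_proj V"

lemma monic: "monic_subspace n (V n)"
  using decomposition unfolding orthogonal_decomposition_def by (elim conjE) (erule spec)

lemma orthogonal: "m \<noteq> n \<Longrightarrow> p \<in> V m \<Longrightarrow> q \<in> V n \<Longrightarrow> poly_inner \<mu> p q = 0"
  using decomposition unfolding orthogonal_decomposition_def by (elim conjE) simp

lemma subspace_V: "mpoly.subspace (V n)"
  using monic unfolding monic_subspace_def by (rule conjunct1)

lemma V_subset: "V n \<subseteq> polys_upto (int n)"
  using monic[of n] unfolding monic_subspace_def by (elim conjE) assumption

lemma unique_components: "\<exists>!f. is_components UNIV V p f"
proof -
  have "direct_sum UNIV V UNIV"
    using decomposition unfolding orthogonal_decomposition_def by (elim conjE) assumption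
  then have "\<forall>p\<in>UNIV. \<exists>!f. is_components UNIV V p f"
    unfolding direct_sum_def by (rule conjunct2)
  then show ?thesis by (rule bspec) (rule UNIV_I)
qed

lemma proj_eq:
  assumes "is_components UNIV V p f" shows "P n p = f n"
proof -
  have "(THE f. is_components UNIV V p f) = f"
    by (rule the1_equality[OF unique_components]) (rule assms)
  then show ?thesis by (simp only: decomp_proj_def)
qed

lemma components_proj: "is_components UNIV V p (\<lambda>n. P n p)"
proof -
  obtain f where f: "is_components UNIV V p f" using unique_components by blast
  from f have "(\<lambda>n. P n p) = f" by (intro ext proj_eq)
  then show ?thesis using f by simp
qed

lemma proj_in: "P n p \<in> V n"
  using components_proj[of p] unfolding is_components_def by blast

lemma proj_add: "P n (p + q) = P n p + P n q"
proof -
  let ?A = "{i. P i p \<noteq> 0} \<union> {i. P i q \<noteq> 0}"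
  have fin: "finite {i. P i r \<noteq> 0}" "r = (\<Sum>i | P i r \<noteq> 0. P i r)" for r
    using components_proj[of r] by (auto simp: is_components_def)
  have "(\<Sum>i\<in>?A. P i p) = p"
    by (rule trans[OF _ fin(2)[symmetric]], rule sum.mono_neutral_right) (use fin(1) in auto)
  moreover have "(\<Sum>i\<in>?A. P i q) = q"
    by (rule trans[OF _ fin(2)[symmetric]], rule sum.mono_neutral_right) (use fin(1) in auto)
  ultimately have "p + q = (\<Sum>i\<in>?A. P i p + P i q)" by (simp add: sum.distrib)
  then have "is_components UNIV V (p + q) (\<lambda>i. P i p + P i q)"
    unfolding is_components_iff using fin(1)[of p] fin(1)[of q]
    by (auto intro!: mpoly.subspace_add subspace_V proj_in exI[of _ ?A])
  then show ?thesis by (rule proj_eq)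
qed

lemma proj_smult: "P n (smult_poly c p) = smult_poly c (P n p)"
proof -
  let ?A = "{i. P i p \<noteq> 0}"
  have fin: "finite ?A" "p = (\<Sum>i\<in>?A. P i p)"
    using components_proj[of p] by (auto simp: is_components_def)
  from fin(2) have "smult_poly c p = (\<Sum>i\<in>?A. smult_poly c (P i p))"
    unfolding mpoly.scale_sum_right[symmetric] by (rule arg_cong)
  then have "is_components UNIV V (smult_poly c p) (\<lambda>i. smult_poly c (P i p))"
    unfolding is_components_iff using fin(1)
    by (auto intro!: mpoly.subspace_scale subspace_V proj_in exI[of _ ?A])
  then show ?thesis by (rule proj_eq)
qed

lemma proj_zero [simp]: "P n 0 = 0"
  using proj_smult[of n 0 0] by simp

lemma proj_diff: "P n (p - q) = P n p - P n q"
  using proj_add[of n "p - q" q] by simp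

lemma proj_sum: "P n (sum f A) = (\<Sum>a\<in>A. P n (f a))"
  by (induction A rule: infinite_finite_induct) (auto simp: proj_add)

lemma proj_on_V:
  assumes "p \<in> V n" shows "P k p = (if k = n then p else 0)"
proof -
  have "is_components UNIV V p (\<lambda>k. if k = n then p else 0)"
    unfolding is_components_iff
    using assms by (auto intro!: exI[of _ "{n}"] mpoly.subspace_0 subspace_V)
  then show ?thesis by (rule proj_eq)
qed

text \<open>
  The decomposition of \<open>polys_upto n\<close> into the first \<open>n + 1\<close> summands, extended by zero, is also a
  decomposition with respect to all summands, so uniqueness identifies it with the projections.
  Used below in two forms: on polynomials of degree at most \<open>n\<close>, \<open>P n\<close> is the identity modulo
  lower degree, and it annihilates polynomials of degree less than \<open>n\<close>.
\<close>

lemma poly_eq_sum_proj: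
  assumes "p \<in> polys_upto (int n)" shows "p = (\<Sum>k\<le>n. P k p)" and "\<And>k. k > n \<Longrightarrow> P k p = 0"
proof -
  obtain f where f: "is_components {..n} V p f"
  proof -
    have "direct_sum {..n} V (polys_upto (int n))"
      using decomposition unfolding orthogonal_decomposition_def by (elim conjE) (erule spec)
    then show ?thesis using assms that unfolding direct_sum_def by (elim conjE) blast
  qed
  then have "f i \<in> V i" for i
    by (cases "i \<le> n") (auto simp: is_components_def mpoly.subspace_0 subspace_V)
  then have "is_components UNIV V p f"
    using f by (auto simp: is_components_def)
  then have P: "P k p = f k" for k by (rule proj_eq)
  show "P k p = 0" if "k > n" for k using f that unfolding P is_components_def by auto
  have "p = sum f {i. f i \<noteq> 0}" using f by (simp add: is_components_def)
  also have "\<dots> = sum f {..n}"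
    using f by (intro sum.mono_neutral_left) (auto simp: is_components_def)
  finally show "p = (\<Sum>k\<le>n. P k p)" unfolding P .
qed

lemma proj_lower_degree:
  assumes "p \<in> polys_upto (int n - 1)" shows "P n p = 0"
proof (cases n)
  case 0
  then show ?thesis using assms by (simp add: polys_upto_minus_one)
next
  case (Suc k)
  then have "p \<in> polys_upto (int k)" using assms by simp
  then show ?thesis using Suc by (intro poly_eq_sum_proj(2)[of p k n]) auto
qed

lemma diff_proj_lower_degree:
  assumes "p \<in> polys_upto (int n)" shows "p - P n p \<in> polys_upto (int n - 1)"
proof -
  have "p = (\<Sum>k<n. P k p) + P n p"
    using poly_eq_sum_proj(1)[OF assms] unfolding lessThan_Suc_atMost[symmetric] by simp
  then have "p - P n p = (\<Sum>k<n. P k p)" unfolding diff_eq_eq .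
  moreover have "P k p \<in> polys_upto (int n - 1)" if "k < n" for k
    using that proj_in[of k p] V_subset[of k] polys_upto_mono[of "int k" "int n - 1"] by auto
  ultimately show ?thesis by (auto intro!: mpoly.subspace_sum subspace_polys_upto)
qed

text \<open>
  On the \<open>n\<close>-th summand only one term of the series defining the creation operator survives.
\<close>

lemma creation_on_V:
  assumes "p \<in> V n" shows "creation V v p = P (Suc n) (X_of v * p)"
proof -
  have "creation V v p = Sum_any (\<lambda>k. if k = n then P (Suc n) (X_of v * p) else 0)"
    unfolding creation_def proj_on_V[OF assms] by (intro arg_cong[where f = Sum_any]) auto
  then show ?thesis by simp
qed

text \<open>
  Replacing a product of degree \<open>n\<close> by its projection changes it by a polynomial of degree below
  \<open>n\<close>. After one more factor \<open>X_of v\<close> this error has degree at most \<open>n\<close>, hence is invisible to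
  \<open>P (n + 1)\<close>; so all projections but the last may be dropped. The right-hand side does not depend on
  the order of \<open>vs\<close>, as is necessary for \<open>U\<^sub>n\<close> to be well defined on symmetrized products.
\<close>

lemma creations_eq_proj:
  "foldr (creation V) vs 1 = P (length vs) (prod_list (map X_of vs))"
proof (induction vs)
  case Nil
  have "1 - P 0 1 \<in> polys_upto (- 1)"
    using diff_proj_lower_degree[of 1 0] one_in_polys_upto by simp
  then show ?case by (simp add: polys_upto_minus_one)
next
  case (Cons v vs)
  let ?n = "length vs" and ?q = "prod_list (map X_of vs)"
  have "X_of v * (?q - P ?n ?q) \<in> polys_upto (int (Suc ?n) - 1)"
    using polys_upto_mult[OF X_of_in_polys_upto diff_proj_lower_degree[OF prod_X_of_in_polys_upto]]
    by simp
  then have "P (Suc ?n) (X_of v * ?q - X_of v * P ?n ?q) = 0"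
    by (subst right_diff_distrib[symmetric]) (rule proj_lower_degree)
  then show ?case
    by (simp add: Cons creation_on_V[OF proj_in] proj_diff)
qed

end

section \<open>Symmetric tensors as coefficient families of homogeneous polynomials\<close>

lemma sum_apply: "(sum f A) x = (\<Sum>a\<in>A. f a x)"
  for f :: "'a \<Rightarrow> 'b \<Rightarrow> 'c::comm_monoid_add"
  by (induction A rule: infinite_finite_induct) auto

lemma finite_lists_of_length [simp]: "finite {is :: 'd::finite list. length is = n}"
  using finite_lists_length_eq[of "UNIV :: 'd set" n] by simp

lemma lists_of_length_Suc:
  "{is. length is = Suc n} = (\<lambda>(i, is). i # is) ` (UNIV \<times> {is. length is = n})"
  by (auto simp: length_Suc_conv image_iff)

text \<open>
  The homogeneous polynomial attached to a tensor by the quotient map of the tensor algebra onto the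
  symmetric algebra: \<open>e\<^bsub>i1\<^esub> \<otimes> \<dots> \<otimes> e\<^bsub>in\<^esub>\<close> goes to the product of the corresponding variables.
\<close>

definition tensor_poly :: "nat \<Rightarrow> 'd::finite tensor \<Rightarrow> 'd mpoly" where
  "tensor_poly n \<xi> = (\<Sum>is | length is = n. smult_poly (\<xi> is) (prod_list (map indet is)))"

abbreviation sym_basis :: "'d::finite list \<Rightarrow> 'd tensor" where
  "sym_basis is \<equiv> sym_product (map (\<lambda>i. axis i 1) is)"

lemma tensor_poly_add: "tensor_poly n (\<xi> + \<eta>) = tensor_poly n \<xi> + tensor_poly n \<eta>"
  by (simp add: tensor_poly_def mpoly.scale_left_distrib sum.distrib)

lemma tensor_poly_smult: "tensor_poly n (smult_tensor c \<xi>) = smult_poly c (tensor_poly n \<xi>)"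
  by (simp add: tensor_poly_def smult_tensor_def mpoly.scale_sum_right)

lemma tensor_poly_pure: "tensor_poly (length vs) (pure_tensor vs) = prod_list (map X_of vs)"
proof (induction vs)
  case Nil
  show ?case by (simp add: tensor_poly_def pure_tensor_def)
next
  case (Cons v vs)
  have "tensor_poly (length (v # vs)) (pure_tensor (v # vs)) =
     (\<Sum>(i, is)\<in>UNIV \<times> {is. length is = length vs}.
        smult_poly (v $ i) (indet i) * smult_poly (pure_tensor vs is) (prod_list (map indet is)))"
    unfolding tensor_poly_def list.size add_Suc_right add_0_right lists_of_length_Suc
    by (subst sum.reindex)
       (auto simp: inj_on_def pure_tensor_Cons smult_poly_mult_left smult_poly_mult_right
          intro!: sum.cong)
  also have "\<dots> = X_of v * tensor_poly (length vs) (pure_tensor vs)"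
    unfolding X_of_def tensor_poly_def sum_product sum.cartesian_product ..
  finally show ?case by (simp add: Cons)
qed

lemma prod_list_map_permute:
  fixes f :: "'a \<Rightarrow> 'b::comm_monoid_mult"
  assumes "\<sigma> permutes {..<length xs}"
  shows "prod_list (map f (permute_list \<sigma> xs)) = prod_list (map f xs)"
proof -
  have "mset (permute_list \<sigma> xs) = mset xs" using assms by (rule mset_permute_list)
  then have "mset (map f (permute_list \<sigma> xs)) = mset (map f xs)" by simp
  then show ?thesis by (metis prod_mset_prod_list)
qed

text \<open>
  All \<open>n!\<close> summands of the symmetrization have the same image, because multiplication of polynomials
  is commutative; this cancels the normalizing factor.
\<close>

lemma tensor_poly_sym_product:
  "tensor_poly (length vs) (sym_product vs) = prod_list (map X_of vs)"
proof -
  let ?n = "length vs" and ?S = "{\<sigma>. \<sigma> permutes {..<length vs}}"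
  have fin: "finite ?S" by (simp add: finite_permutations)
  have "tensor_poly ?n (sym_product vs) =
      smult_poly (1 / fact ?n) (\<Sum>\<sigma>\<in>?S. tensor_poly ?n (pure_tensor (permute_list \<sigma> vs)))"
    unfolding tensor_poly_def sym_product_def
    by (subst sum.swap) (simp add: mpoly.scale_sum_right mpoly.scale_sum_left sum_distrib_left)
  also have "(\<Sum>\<sigma>\<in>?S. tensor_poly ?n (pure_tensor (permute_list \<sigma> vs))) =
      (\<Sum>\<sigma>\<in>?S. prod_list (map X_of vs))"
  proof (rule sum.cong[OF refl])
    fix \<sigma> assume "\<sigma> \<in> ?S"
    then show "tensor_poly ?n (pure_tensor (permute_list \<sigma> vs)) = prod_list (map X_of vs)"
      using tensor_poly_pure[of "permute_list \<sigma> vs"] by (simp add: prod_list_map_permute)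
  qed
  also have "\<dots> = smult_poly (of_nat (card ?S)) (prod_list (map X_of vs))"
    by (rule mpoly.sum_constant_scale)
  also have "card ?S = fact ?n"
    by (rule card_permutations) auto
  finally show ?thesis by simp
qed

lemma pure_tensor_permute:
  assumes "\<sigma> permutes {..<length vs}" "length is = length vs"
  shows "pure_tensor (permute_list \<sigma> vs) (permute_list \<sigma> is) = pure_tensor vs is"
proof -
  have "(\<Prod>k<length vs. vs ! \<sigma> k $ (is ! \<sigma> k)) = (\<Prod>k<length vs. vs ! k $ (is ! k))"
    using prod.permute[OF assms(1), of "\<lambda>k. vs ! k $ (is ! k)"] by (simp add: o_def)
  then show ?thesis
    using assms by (simp add: pure_tensor_def permute_list_nth)
qed

text \<open>
  Permuting the coordinates by \<open>\<tau>\<close> amounts to reindexing the sum over all permutations by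
  composition with \<open>\<tau>\<close>.
\<close>

lemma sym_product_in: "sym_product vs \<in> sym_tensors (length vs)"
proof -
  have "sym_product vs (permute_list \<tau> is) = sym_product vs is"
    if len: "length is = length vs" and \<tau>: "\<tau> permutes {..<length vs}" for \<tau> "is"
  proof -
    have "pure_tensor (permute_list (\<sigma> \<circ> \<tau>) vs) (permute_list \<tau> is) = pure_tensor (permute_list \<sigma> vs) is"
      for \<sigma> using \<tau> len by (simp add: permute_list_compose pure_tensor_permute)
    then show ?thesis unfolding sym_product_def
      by (subst sum_permutations_compose_right[OF \<tau>]) simp
  qed
  then show ?thesis
    by (auto simp: sym_tensors_def sym_product_def pure_tensor_def)
qed

lemma pure_tensor_axis:
  "pure_tensor (map (\<lambda>i. axis i 1) is) js = (if js = is then 1 else 0)"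
proof (cases "length js = length is")
  case True
  then show ?thesis
    by (auto simp: pure_tensor_def axis_def list_eq_iff_nth_eq)
qed (auto simp: pure_tensor_def)

lemma sym_tensors_zero: "0 \<in> sym_tensors n"
  and sym_tensors_add: "\<xi> \<in> sym_tensors n \<Longrightarrow> \<eta> \<in> sym_tensors n \<Longrightarrow> \<xi> + \<eta> \<in> sym_tensors n"
  and sym_tensors_diff: "\<xi> \<in> sym_tensors n \<Longrightarrow> \<eta> \<in> sym_tensors n \<Longrightarrow> \<xi> - \<eta> \<in> sym_tensors n"
  and sym_tensors_smult: "\<xi> \<in> sym_tensors n \<Longrightarrow> smult_tensor c \<xi> \<in> sym_tensors n"
  by (auto simp: sym_tensors_def smult_tensor_def)

lemma sym_basis_in: "length is = n \<Longrightarrow> sym_basis is \<in> sym_tensors n"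
  using sym_product_in[of "map (\<lambda>i. axis i 1) is"] by simp

text \<open>
  A symmetric tensor is its own symmetrization, so symmetrizing its expansion in the tensor basis
  changes nothing. Consequently a linear map on symmetric tensors is determined by its values on
  symmetrized products, which gives the uniqueness of the operators \<open>U\<^sub>n\<close>.
\<close>

lemma sym_tensor_expansion:
  assumes \<xi>: "\<xi> \<in> sym_tensors n"
  shows "\<xi> = (\<Sum>is | length is = n. smult_tensor (\<xi> is) (sym_basis is))"
proof
  fix js
  let ?S = "{\<sigma>. \<sigma> permutes {..<n}}"
  show "\<xi> js = (\<Sum>is | length is = n. smult_tensor (\<xi> is) (sym_basis is)) js"
  proof (cases "length js = n")
    case False
    then have "sym_basis is js = 0" if "length is = n" for "is"
      using sym_basis_in[OF that] by (simp add: sym_tensors_def)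
    then show ?thesis using \<xi> False
      by (simp add: sum_apply smult_tensor_def sym_tensors_def)
  next
    case True
    \<comment> \<open>For a fixed permutation exactly one basis index contributes to the coordinate \<open>js\<close>, and
      symmetry of \<open>\<xi>\<close> makes its coefficient equal to \<open>\<xi> js\<close>.\<close>
    have one: "(\<Sum>is | length is = n. \<xi> is * (if js = permute_list \<sigma> is then 1 else 0)) = \<xi> js"
      if \<sigma>: "\<sigma> permutes {..<n}" for \<sigma>
    proof -
      have inv: "inv \<sigma> permutes {..<n}" by (rule permutes_inv[OF \<sigma>])
      have "js = permute_list \<sigma> is \<longleftrightarrow> is = permute_list (inv \<sigma>) js" if "length is = n" for "is"
        using that True \<sigma> inv permutes_inv_o[OF \<sigma>]
        by (metis length_permute_list permute_list_compose permute_list_id)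
      then have "(\<Sum>is | length is = n. \<xi> is * (if js = permute_list \<sigma> is then 1 else 0)) =
          (\<Sum>is | length is = n. if is = permute_list (inv \<sigma>) js then \<xi> is else 0)"
        by (intro sum.cong) auto
      also have "\<dots> = \<xi> (permute_list (inv \<sigma>) js)"
        using True by simp
      also have "\<dots> = \<xi> js" using \<xi> inv True by (simp add: sym_tensors_def)
      finally show ?thesis .
    qed
    have "(\<Sum>is | length is = n. smult_tensor (\<xi> is) (sym_basis is)) js =
        (\<Sum>is | length is = n. \<xi> is * (1 / fact n * (\<Sum>\<sigma>\<in>?S. if js = permute_list \<sigma> is then 1 else 0)))"
      unfolding sum_apply
      by (intro sum.cong) (auto simp: smult_tensor_def sym_product_def permute_list_map pure_tensor_axis
          intro!: sum.cong)
    also have "\<dots> = 1 / fact n * (\<Sum>\<sigma>\<in>?S. \<Sum>is | length is = n. \<xi> is * (if js = permute_list \<sigma> is then 1 else 0))"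
      by (subst sum.swap) (simp add: sum_distrib_left mult.left_commute del: mult_if_delta)
    also have "\<dots> = 1 / fact n * (of_nat (card ?S) * \<xi> js)"
      using one by simp
    also have "card ?S = fact n"
      by (rule card_permutations) auto
    finally show ?thesis by simp
  qed
qed

lemma linear_on_sum:
  assumes lin: "is_linear_on (sym_tensors n) sm F"
    and t: "\<And>a. a \<in> A \<Longrightarrow> t a \<in> sym_tensors n"
  shows "F (\<Sum>a\<in>A. smult_tensor (c a) (t a)) = (\<Sum>a\<in>A. sm (c a) (F (t a)))"
    and "(\<Sum>a\<in>A. smult_tensor (c a) (t a)) \<in> sym_tensors n"
proof -
  have "F (0 + 0) = F 0 + F 0"
    using lin sym_tensors_zero unfolding is_linear_on_def by blast
  then have "F 0 = 0" by simp
  then have "F (\<Sum>a\<in>A. smult_tensor (c a) (t a)) = (\<Sum>a\<in>A. sm (c a) (F (t a))) \<and>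
    (\<Sum>a\<in>A. smult_tensor (c a) (t a)) \<in> sym_tensors n"
    using t
  proof (induction A rule: infinite_finite_induct)
    case (insert a A)
    let ?x = "smult_tensor (c a) (t a)" and ?y = "\<Sum>a\<in>A. smult_tensor (c a) (t a)"
    have x: "?x \<in> sym_tensors n" and Fx: "F ?x = sm (c a) (F (t a))"
      using lin insert.prems by (auto intro: sym_tensors_smult simp: is_linear_on_def)
    have y: "?y \<in> sym_tensors n" and Fy: "F ?y = (\<Sum>a\<in>A. sm (c a) (F (t a)))"
      using insert by auto
    have "F (?x + ?y) = F ?x + F ?y"
      using lin x y unfolding is_linear_on_def by blast
    then show ?case
      unfolding sum.insert[OF insert.hyps] Fx Fy using sym_tensors_add[OF x y] by blast
  qed (auto simp: sym_tensors_zero)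
  then show "F (\<Sum>a\<in>A. smult_tensor (c a) (t a)) = (\<Sum>a\<in>A. sm (c a) (F (t a)))"
    "(\<Sum>a\<in>A. smult_tensor (c a) (t a)) \<in> sym_tensors n" by auto
qed

lemma linear_on_expansion:
  assumes "is_linear_on (sym_tensors n) sm F" and \<xi>: "\<xi> \<in> sym_tensors n"
  shows "F \<xi> = (\<Sum>is | length is = n. sm (\<xi> is) (F (sym_basis is)))"
  by (subst sym_tensor_expansion[OF \<xi>], subst linear_on_sum[OF assms(1)])
     (auto intro: sym_basis_in)

section \<open>The operators from symmetric tensors to orthogonal polynomials\<close>

context monic_decomposition
begin

text \<open>
  The projected polynomial of a tensor has the properties that determine \<open>U\<^sub>n\<close>, by
  \<open>creations_eq_proj\<close>; uniqueness is the expansion of symmetric tensors in symmetrized products.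
\<close>

lemma U_op_eq: "U_op V n = restrict (\<lambda>\<xi>. P n (tensor_poly n \<xi>)) (sym_tensors n)"
  unfolding U_op_def
proof (rule the_equality)
  let ?U = "restrict (\<lambda>\<xi>. P n (tensor_poly n \<xi>)) (sym_tensors n)"
  show "?U \<in> sym_tensors n \<rightarrow>\<^sub>E V n \<and> is_linear_on (sym_tensors n) smult_poly ?U \<and>
      (\<forall>vs. length vs = n \<longrightarrow> ?U (sym_product vs) = foldr (creation V) vs 1)"
    by (auto simp: proj_in is_linear_on_def sym_tensors_add sym_tensors_smult tensor_poly_add
        tensor_poly_smult proj_add proj_smult sym_product_in tensor_poly_sym_product creations_eq_proj)
next
  fix U :: "'d tensor \<Rightarrow> 'd mpoly"
  assume U: "U \<in> sym_tensors n \<rightarrow>\<^sub>E V n \<and> is_linear_on (sym_tensors n) smult_poly U \<and>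
      (\<forall>vs. length vs = n \<longrightarrow> U (sym_product vs) = foldr (creation V) vs 1)"
  show "U = restrict (\<lambda>\<xi>. P n (tensor_poly n \<xi>)) (sym_tensors n)"
  proof (rule extensionalityI[where A = "sym_tensors n :: 'd tensor set"])
    show "U \<in> extensional (sym_tensors n)" using U by (auto simp: PiE_def)
    fix \<xi> :: "'d tensor" assume \<xi>: "\<xi> \<in> sym_tensors n"
    have "U \<xi> = (\<Sum>is | length is = n. smult_poly (\<xi> is) (U (sym_basis is)))"
      using U \<xi> by (intro linear_on_expansion) auto
    also have "\<dots> = P n (tensor_poly n \<xi>)"
      using U by (simp add: tensor_poly_def proj_sum proj_smult creations_eq_proj X_of_axis o_def)
    finally show "U \<xi> = restrict (\<lambda>\<xi>. P n (tensor_poly n \<xi>)) (sym_tensors n) \<xi>"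
      using \<xi> by simp
  qed auto
qed

lemma linear_U: "is_linear_on (sym_tensors n) smult_poly (U_op V n)"
  by (auto simp: U_op_eq is_linear_on_def sym_tensors_add sym_tensors_smult tensor_poly_add
        tensor_poly_smult proj_add proj_smult)

lemma U_op_sym_basis: "length is = n \<Longrightarrow> U_op V n (sym_basis is) = P n (prod_list (map indet is))"
  using tensor_poly_sym_product[of "map (\<lambda>i. axis i 1) is"]
  by (auto simp: U_op_eq sym_basis_in X_of_axis o_def)

text \<open>
  An element of \<open>V n\<close> is fixed by \<open>P n\<close>, hence a combination of projected monomials. Those of
  degree \<open>n\<close> are values of \<open>U\<^sub>n\<close>, and those of lower degree project to zero.
\<close>

lemma V_spanned_by_U:
  assumes p: "p \<in> V n"
  shows "p \<in> mpoly.span (U_op V n ` sym_tensors n)"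
proof -
  have "p = P n p" using proj_on_V[OF p] by simp
  also have "\<dots> = P n (\<Sum>m\<in>Poly_Mapping.keys p. smult_poly (coeff_of p m) (Poly_Mapping.single m 1))"
    using poly_eq_sum_monomials[of p] by (simp add: smult_poly_single)
  also have "\<dots> = (\<Sum>m\<in>Poly_Mapping.keys p. smult_poly (coeff_of p m) (P n (Poly_Mapping.single m 1)))"
    by (simp add: proj_sum proj_smult)
  also have "\<dots> \<in> mpoly.span (U_op V n ` sym_tensors n)"
  proof (intro mpoly.span_sum mpoly.span_scale)
    fix m assume m: "m \<in> Poly_Mapping.keys p"
    show "P n (Poly_Mapping.single m 1) \<in> mpoly.span (U_op V n ` sym_tensors n)"
    proof (cases "monom_degree m = n")
      case True
      then obtain "is" where "length is = n" "Poly_Mapping.single m 1 = prod_list (map indet is)"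
        using monomial_as_product_of_indets by metis
      then have "P n (Poly_Mapping.single m 1) = U_op V n (sym_basis is)"
        by (simp add: U_op_sym_basis)
      then show ?thesis
        using \<open>length is = n\<close> by (auto intro!: mpoly.span_base sym_basis_in)
    next
      case False
      then have "int (monom_degree m) \<le> int n - 1"
        using m p V_subset[of n] by (force simp: polys_upto_def)
      then have "P n (Poly_Mapping.single m 1) = 0"
        by (intro proj_lower_degree single_in_polys_upto)
      then show ?thesis by (simp add: mpoly.span_zero)
    qed
  qed
  finally show ?thesis .
qed

end

section \<open>The pre-scalar product\<close>

abbreviation value_at :: "'d::finite mpoly \<Rightarrow> real ^ 'd \<Rightarrow> complex" where
  "value_at p x \<equiv> eval_poly p (\<chi> j. complex_of_real (x $ j))"

locale moment_decomposition = monic_decomposition \<mu> V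
  for \<mu> :: "(real ^ 'd::finite) measure" and V +
  assumes moments: "finite_moments \<mu>"
begin

lemma value_at_monomials:
  "value_at p x = (\<Sum>m\<in>Poly_Mapping.keys p.
     coeff_of p m * complex_of_real (\<Prod>j\<in>UNIV. (x $ j) ^ Poly_Mapping.lookup m j))"
  by (simp add: eval_poly_def)

text \<open>
  At real points conjugation affects only the coefficients, so the product is a combination of
  monomials with exponents \<open>m + m'\<close>, which are integrable because all moments are finite.
\<close>

lemma integrable_product: "integrable \<mu> (\<lambda>x. cnj (value_at p x) * value_at q x)"
proof -
  have "integrable \<mu> (\<lambda>x. \<Sum>m\<in>Poly_Mapping.keys p. \<Sum>m'\<in>Poly_Mapping.keys q.
      cnj (coeff_of p m) * coeff_of q m' *
        complex_of_real (\<Prod>j\<in>UNIV. (x $ j) ^ (Poly_Mapping.lookup m j + Poly_Mapping.lookup m' j)))"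
  proof (intro Bochner_Integration.integrable_sum integrable_mult_right integrable_of_real)
    fix m m' :: "'d \<Rightarrow>\<^sub>0 nat"
    show "integrable \<mu>
        (\<lambda>x. \<Prod>j\<in>UNIV. (x $ j) ^ (Poly_Mapping.lookup m j + Poly_Mapping.lookup m' j))"
      using moments unfolding finite_moments_def by (rule spec)
  qed
  then show ?thesis
    unfolding value_at_monomials cnj_sum sum_product
    by (simp add: power_add prod.distrib mult_ac)
qed

lemma measurable_value_at [measurable]: "value_at p \<in> borel_measurable \<mu>"
  using integrable_product[of 1 p] by simp

lemma poly_inner_add_right: "poly_inner \<mu> p (q + r) = poly_inner \<mu> p q + poly_inner \<mu> p r"
  unfolding poly_inner_def
  by (simp add: distrib_left integrable_product)

lemma poly_inner_add_left: "poly_inner \<mu> (q + r) p = poly_inner \<mu> q p + poly_inner \<mu> r p"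
  unfolding poly_inner_def
  by (simp add: distrib_right integrable_product)

lemma poly_inner_smult_right: "poly_inner \<mu> p (smult_poly c q) = c * poly_inner \<mu> p q"
  unfolding poly_inner_def by (simp add: mult.left_commute[of _ c])

lemma poly_inner_smult_left: "poly_inner \<mu> (smult_poly c q) p = cnj c * poly_inner \<mu> q p"
  unfolding poly_inner_def by (simp add: mult.assoc)

lemma poly_inner_zero_left [simp]: "poly_inner \<mu> 0 p = 0"
  by (simp add: poly_inner_def)

lemma poly_inner_sum_left: "poly_inner \<mu> (sum f A) p = (\<Sum>a\<in>A. poly_inner \<mu> (f a) p)"
  by (induction A rule: infinite_finite_induct) (auto simp: poly_inner_add_left)

definition vanishes :: "'d mpoly \<Rightarrow> bool" where
  "vanishes p \<longleftrightarrow> (AE x in \<mu>. value_at p x = 0)"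

lemma vanishes_zero: "vanishes 0"
  by (simp add: vanishes_def)

lemma vanishes_add: "vanishes p \<Longrightarrow> vanishes q \<Longrightarrow> vanishes (p + q)"
  unfolding vanishes_def by (elim AE_mp) (auto intro!: AE_I2)

lemma subspace_vanishing: "mpoly.subspace {p. vanishes p}"
  by (intro mpoly.subspaceI) (auto simp: vanishes_zero vanishes_add, auto simp: vanishes_def)

lemma poly_inner_self_eq_0_iff: "poly_inner \<mu> p p = 0 \<longleftrightarrow> vanishes p"
proof -
  have sq: "cnj z * z = complex_of_real ((norm z)\<^sup>2)" for z
    using complex_norm_square[of z] by (simp add: mult.commute)
  have int: "integrable \<mu> (\<lambda>x. (norm (value_at p x))\<^sup>2)"
    using integrable_product[of p p, THEN integrable_norm] by (simp add: norm_mult power2_eq_square)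
  have "poly_inner \<mu> p p = complex_of_real (\<integral>x. (norm (value_at p x))\<^sup>2 \<partial>\<mu>)"
    unfolding poly_inner_def sq by (rule integral_complex_of_real)
  then have "poly_inner \<mu> p p = 0 \<longleftrightarrow> (\<integral>x. (norm (value_at p x))\<^sup>2 \<partial>\<mu>) = 0"
    by (simp only: of_real_eq_0_iff)
  also have "\<dots> \<longleftrightarrow> (AE x in \<mu>. (norm (value_at p x))\<^sup>2 = 0)"
    by (intro integral_nonneg_eq_0_iff_AE int) auto
  finally show ?thesis by (simp add: vanishes_def)
qed

lemma poly_inner_cong_left:
  assumes "vanishes (p - q)" shows "poly_inner \<mu> p r = poly_inner \<mu> q r"
  unfolding poly_inner_def
  using assms unfolding vanishes_def
  by (intro integral_cong_AE borel_measurable_integrable integrable_product) auto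

lemma poly_inner_vanishes_left: "vanishes p \<Longrightarrow> poly_inner \<mu> p q = 0"
  using poly_inner_cong_left[of p 0 q] by simp

section \<open>The Jacobi sequence\<close>

lemma tensor_inner_definite:
  assumes "\<delta> \<in> sym_tensors n" "tensor_inner n \<delta> \<delta> = 0"
  shows "\<delta> = 0"
proof
  fix js
  have "cnj z * z = complex_of_real ((norm z)\<^sup>2)" for z
    using complex_norm_square[of z] by (simp add: mult.commute)
  then have "complex_of_real (\<Sum>is | length is = n. (norm (\<delta> is))\<^sup>2) = 0"
    using assms(2) by (simp add: tensor_inner_def)
  then have "(\<Sum>is | length is = n. (norm (\<delta> is))\<^sup>2) = 0"
    by (simp only: of_real_eq_0_iff)
  then show "\<delta> js = 0 js"
    using assms(1) by (cases "length js = n") (auto simp: sum_nonneg_eq_0_iff sym_tensors_def)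
qed

text \<open>
  Pairing a symmetric tensor with \<open>sym_basis is\<close> reads off its coordinate at the index \<open>is\<close>, so these
  coordinates are forced by the defining equation of \<open>\<Omega>\<^sub>n\<close>.
\<close>

definition jacobi_matrix :: "nat \<Rightarrow> 'd tensor \<Rightarrow> 'd tensor" where
  "jacobi_matrix n \<eta> =
    (\<lambda>is. if length is = n then poly_inner \<mu> (U_op V n (sym_basis is)) (U_op V n \<eta>) else 0)"

lemma jacobi_matrix_in: "jacobi_matrix n \<eta> \<in> sym_tensors n"
  by (auto simp: sym_tensors_def jacobi_matrix_def U_op_sym_basis prod_list_map_permute)

lemma tensor_inner_jacobi_matrix:
  assumes \<xi>: "\<xi> \<in> sym_tensors n"
  shows "tensor_inner n \<xi> (jacobi_matrix n \<eta>) = poly_inner \<mu> (U_op V n \<xi>) (U_op V n \<eta>)"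
proof -
  have "poly_inner \<mu> (U_op V n \<xi>) (U_op V n \<eta>) =
      poly_inner \<mu> (\<Sum>is | length is = n. smult_poly (\<xi> is) (U_op V n (sym_basis is))) (U_op V n \<eta>)"
    by (subst linear_on_expansion[OF linear_U \<xi>]) (rule refl)
  also have "\<dots> = tensor_inner n \<xi> (jacobi_matrix n \<eta>)"
    by (simp add: poly_inner_sum_left poly_inner_smult_left tensor_inner_def jacobi_matrix_def)
  finally show ?thesis ..
qed

text \<open>
  Two operators with the defining property differ, at each \<open>\<eta>\<close>, by a symmetric tensor that is
  orthogonal to all symmetric tensors, in particular to itself; as the tensor scalar product is
  definite, the difference is zero.
\<close>

lemma jacobi_op_eq: "jacobi_op \<mu> V n = restrict (jacobi_matrix n) (sym_tensors n)"
  unfolding jacobi_op_def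
proof (rule the_equality)
  let ?\<Omega> = "restrict (jacobi_matrix n) (sym_tensors n)"
  have "jacobi_matrix n (\<xi> + \<eta>) = jacobi_matrix n \<xi> + jacobi_matrix n \<eta>"
    if "\<xi> \<in> sym_tensors n" "\<eta> \<in> sym_tensors n" for \<xi> \<eta>
    using that linear_U[of n] by (auto simp: is_linear_on_def jacobi_matrix_def poly_inner_add_right)
  moreover have "jacobi_matrix n (smult_tensor c \<xi>) = smult_tensor c (jacobi_matrix n \<xi>)"
    if "\<xi> \<in> sym_tensors n" for c \<xi>
  proof -
    have "U_op V n (smult_tensor c \<xi>) = smult_poly c (U_op V n \<xi>)"
      using that linear_U[of n] unfolding is_linear_on_def by blast
    then show ?thesis
      by (auto simp: jacobi_matrix_def poly_inner_smult_right smult_tensor_def)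
  qed
  ultimately have "is_linear_on (sym_tensors n) smult_tensor ?\<Omega>"
    by (simp add: is_linear_on_def sym_tensors_add sym_tensors_smult)
  then show "?\<Omega> \<in> sym_tensors n \<rightarrow>\<^sub>E sym_tensors n \<and>
      is_linear_on (sym_tensors n) smult_tensor ?\<Omega> \<and>
      (\<forall>\<xi>\<in>sym_tensors n. \<forall>\<eta>\<in>sym_tensors n.
        tensor_inner n \<xi> (?\<Omega> \<eta>) = poly_inner \<mu> (U_op V n \<xi>) (U_op V n \<eta>))"
    by (auto simp: jacobi_matrix_in tensor_inner_jacobi_matrix)
next
  fix \<Omega> :: "'d tensor \<Rightarrow> 'd tensor"
  assume \<Omega>: "\<Omega> \<in> sym_tensors n \<rightarrow>\<^sub>E sym_tensors n \<and>
      is_linear_on (sym_tensors n) smult_tensor \<Omega> \<and>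
      (\<forall>\<xi>\<in>sym_tensors n. \<forall>\<eta>\<in>sym_tensors n.
        tensor_inner n \<xi> (\<Omega> \<eta>) = poly_inner \<mu> (U_op V n \<xi>) (U_op V n \<eta>))"
  show "\<Omega> = restrict (jacobi_matrix n) (sym_tensors n)"
  proof (rule extensionalityI[where A = "sym_tensors n :: 'd tensor set"])
    show "\<Omega> \<in> extensional (sym_tensors n)" using \<Omega> by (auto simp: PiE_def)
    fix \<eta> :: "'d tensor" assume \<eta>: "\<eta> \<in> sym_tensors n"
    define \<delta> where "\<delta> = \<Omega> \<eta> - jacobi_matrix n \<eta>"
    have "\<Omega> \<eta> \<in> sym_tensors n" using \<Omega> \<eta> by blast
    then have \<delta>: "\<delta> \<in> sym_tensors n"
      unfolding \<delta>_def by (intro sym_tensors_diff jacobi_matrix_in)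
    have "tensor_inner n \<delta> \<delta> = tensor_inner n \<delta> (\<Omega> \<eta>) - tensor_inner n \<delta> (jacobi_matrix n \<eta>)"
      by (subst (2) \<delta>_def) (simp add: tensor_inner_def right_diff_distrib sum_subtractf)
    also have "\<dots> = 0" using \<Omega> \<delta> \<eta> by (simp add: tensor_inner_jacobi_matrix)
    finally have "\<delta> = 0" by (rule tensor_inner_definite[OF \<delta>])
    then have "\<Omega> \<eta> = jacobi_matrix n \<eta>" unfolding \<delta>_def by (rule right_minus_eq[THEN iffD1])
    then show "\<Omega> \<eta> = restrict (jacobi_matrix n) (sym_tensors n) \<eta>"
      using \<eta> by auto
  qed auto
qed

text \<open>
  If \<open>\<Omega>\<^sub>n = 0\<close>, every value of \<open>U\<^sub>n\<close> has norm zero and so vanishes almost everywhere. Null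
  polynomials form a subspace, and the values of \<open>U\<^sub>n\<close> span \<open>V n\<close>.
\<close>

lemma jacobi_op_zero_iff:
  "(\<forall>\<eta>\<in>sym_tensors n. jacobi_op \<mu> V n \<eta> = 0) \<longleftrightarrow> (\<forall>p\<in>V n. vanishes p)"
proof
  assume 0: "\<forall>\<eta>\<in>sym_tensors n. jacobi_op \<mu> V n \<eta> = 0"
  have "vanishes (U_op V n \<xi>)" if "\<xi> \<in> sym_tensors n" for \<xi>
  proof -
    have "poly_inner \<mu> (U_op V n \<xi>) (U_op V n \<xi>) = tensor_inner n \<xi> 0"
      using 0 that tensor_inner_jacobi_matrix[OF that, of \<xi>] by (simp add: jacobi_op_eq)
    then show ?thesis by (simp add: tensor_inner_def poly_inner_self_eq_0_iff)
  qed
  then have "mpoly.span (U_op V n ` sym_tensors n) \<subseteq> {p. vanishes p}"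
    by (intro mpoly.span_minimal subspace_vanishing) auto
  then show "\<forall>p\<in>V n. vanishes p" using V_spanned_by_U by blast
next
  assume "\<forall>p\<in>V n. vanishes p"
  then have "vanishes (U_op V n (sym_basis is))" if "length is = n" for "is"
    using that by (simp add: U_op_sym_basis proj_in)
  then show "\<forall>\<eta>\<in>sym_tensors n. jacobi_op \<mu> V n \<eta> = 0"
    by (auto simp: jacobi_op_eq jacobi_matrix_def poly_inner_vanishes_left)
qed

end

section \<open>Finitely supported measures\<close>

text \<open>
  On a finite set of full measure, \<open>\<mu>\<close> is the sum of its point masses. Points of mass zero have to
  be discarded since the weights are required to be positive.
\<close>

lemma finitely_atomic_iff:
  fixes \<mu> :: "(real ^ 'd) measure"
  assumes "prob_space \<mu>" and sets: "sets \<mu> = sets borel"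
  shows "(\<exists>F. finite F \<and> (AE x in \<mu>. x \<in> F)) \<longleftrightarrow>
    (\<exists>(I :: nat set) (a :: nat \<Rightarrow> real) (x :: nat \<Rightarrow> real ^ 'd).
       finite I \<and> (\<forall>i\<in>I. a i > 0) \<and> (\<Sum>i\<in>I. a i) = 1 \<and>
       (\<forall>A\<in>sets borel. emeasure \<mu> A = (\<Sum>i\<in>I. ennreal (a i) * emeasure (return borel (x i)) A)))"
    (is "_ \<longleftrightarrow> ?R")
proof
  interpret prob_space \<mu> by fact
  have space: "space \<mu> = UNIV" using sets_eq_imp_space_eq[OF sets] by simp
  have fin_sets: "S \<in> sets \<mu>" if "finite S" for S
    using that unfolding sets by (simp add: finite_imp_closed)
  assume "\<exists>F. finite F \<and> (AE x in \<mu>. x \<in> F)"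
  then obtain F where F: "finite F" "AE x in \<mu>. x \<in> F" by blast
  define G where "G = {x\<in>F. prob {x} > 0}"
  have "finite G" using F by (simp add: G_def)
  then obtain h where h: "bij_betw h {0..<card G} G"
    using ex_bij_betw_nat_finite by blast
  have main: "emeasure \<mu> A = (\<Sum>i\<in>{0..<card G}. ennreal (prob {h i}) * emeasure (return borel (h i)) A)"
    if A: "A \<in> sets borel" for A
  proof -
    have "emeasure \<mu> A = emeasure \<mu> (A \<inter> F)"
    proof (rule emeasure_eq_AE)
      show "AE x in \<mu>. x \<in> A \<longleftrightarrow> x \<in> A \<inter> F" using F(2) by eventually_elim simp
    qed (use A F(1) fin_sets sets in auto)
    also have "\<dots> = (\<Sum>x\<in>A \<inter> F. emeasure \<mu> {x})"
      using F(1) fin_sets by (intro emeasure_eq_sum_singleton) auto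
    also have "\<dots> = (\<Sum>x\<in>F. emeasure \<mu> {x} * indicator A x)"
      using F(1) by (intro sum.mono_neutral_cong_left) (auto simp: indicator_def)
    also have "\<dots> = (\<Sum>x\<in>G. emeasure \<mu> {x} * indicator A x)"
    proof (rule sum.mono_neutral_right)
      show "\<forall>x\<in>F - G. emeasure \<mu> {x} * indicator A x = 0"
        by (auto simp: G_def emeasure_eq_measure not_less measure_le_0_iff)
    qed (use F(1) in \<open>auto simp: G_def\<close>)
    also have "\<dots> = (\<Sum>i\<in>{0..<card G}. emeasure \<mu> {h i} * indicator A (h i))"
      using sum.reindex_bij_betw[OF h, of "\<lambda>x. emeasure \<mu> {x} * indicator A x"] by simp
    finally show ?thesis using A by (simp add: emeasure_eq_measure)
  qed
  have pos: "\<forall>i\<in>{0..<card G}. prob {h i} > 0"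
    using h by (auto simp: bij_betw_def G_def)
  have "ennreal (\<Sum>i\<in>{0..<card G}. prob {h i}) = emeasure \<mu> UNIV"
    using main[of UNIV] by (simp add: sum_ennreal)
  also have "\<dots> = 1" using emeasure_space_1 by (simp add: space)
  finally have "(\<Sum>i\<in>{0..<card G}. prob {h i}) = 1" by simp
  then show ?R using main pos
    by (intro exI[of _ "{0..<card G}"] exI[of _ "\<lambda>i. prob {h i}"] exI[of _ h]) auto
next
  assume ?R
  then obtain I :: "nat set" and a and x :: "nat \<Rightarrow> real ^ 'd" where fin: "finite I"
    and em: "\<And>A. A \<in> sets borel \<Longrightarrow>
      emeasure \<mu> A = (\<Sum>i\<in>I. ennreal (a i) * emeasure (return borel (x i)) A)" by blast
  have sF: "- (x ` I) \<in> sets borel" using fin by (simp add: finite_imp_closed borel_comp)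
  then have "emeasure \<mu> (- (x ` I)) = 0" by (simp add: em)
  then have "AE y in \<mu>. y \<notin> - (x ` I)"
    using sF sets by (intro AE_not_in) (auto simp: null_sets_def)
  then show "\<exists>F. finite F \<and> (AE x in \<mu>. x \<in> F)"
    using fin by (intro exI[of _ "x ` I"]) auto
qed

section \<open>Interpolation\<close>

text \<open>
  One linear factor per point \<open>y\<close> of \<open>S\<close>: it uses a coordinate in which \<open>z\<close> and \<open>y\<close> differ.
\<close>

lemma exists_separating_poly:
  fixes z :: "real ^ 'd::finite"
  assumes "finite S" "z \<notin> S"
  shows "\<exists>q\<in>polys_upto (int (card S)). value_at q z = 1 \<and> (\<forall>x\<in>S. value_at q x = 0)"
  using assms
proof (induction S)
  case empty
  then show ?case using one_in_polys_upto by (intro bexI[of _ 1]) auto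
next
  case (insert y S)
  then obtain q where q: "q \<in> polys_upto (int (card S))" "value_at q z = 1"
    "\<forall>x\<in>S. value_at q x = 0" by auto
  obtain j where j: "z $ j \<noteq> y $ j" using insert.prems by (auto simp: vec_eq_iff)
  define l where "l = smult_poly (1 / complex_of_real (z $ j - y $ j))
    (indet j - smult_poly (complex_of_real (y $ j)) 1)"
  have "l \<in> polys_upto 1"
    unfolding l_def using one_in_polys_upto polys_upto_mono[of 0 1]
    by (intro mpoly.subspace_scale mpoly.subspace_diff subspace_polys_upto indet_in_polys_upto) auto
  then have "q * l \<in> polys_upto (int (card (insert y S)))"
    using polys_upto_mult[OF q(1), of l 1] insert.hyps by (simp add: add.commute)
  moreover have "value_at l z = 1" "value_at l y = 0"
    using j by (auto simp: l_def)
  ultimately show ?case using q by (intro bexI[of _ "q * l"]) auto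
qed

text \<open>
  Newton's scheme: add one node at a time and correct the value there by a multiple of a polynomial
  that vanishes at the earlier nodes. Only a degree bound that depends on the number of nodes alone
  matters for the application.
\<close>

lemma interpolation:
  fixes f :: "real ^ 'd::finite \<Rightarrow> complex"
  assumes "finite S"
  shows "\<exists>r\<in>polys_upto (int (card S)). \<forall>x\<in>S. value_at r x = f x"
  using assms
proof (induction S)
  case empty
  then show ?case by (auto intro!: bexI[of _ 0] mpoly.subspace_0 subspace_polys_upto)
next
  case (insert z S)
  then obtain r where r: "r \<in> polys_upto (int (card S))" "\<forall>x\<in>S. value_at r x = f x" by blast
  obtain q where q: "q \<in> polys_upto (int (card S))" "value_at q z = 1" "\<forall>x\<in>S. value_at q x = 0"
    using exists_separating_poly insert.hyps by blast
  let ?r = "r + smult_poly (f z - value_at r z) q"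
  have "?r \<in> polys_upto (int (card S))"
    using r q by (intro mpoly.subspace_add mpoly.subspace_scale subspace_polys_upto)
  also have "\<dots> \<subseteq> polys_upto (int (card (insert z S)))"
    using insert.hyps by (intro polys_upto_mono) auto
  finally show ?case using r q by (intro bexI[of _ ?r]) auto
qed

section \<open>Eventual vanishing and finite support\<close>

lemma polys_upto_finitely_spanned:
  "\<exists>B. finite B \<and> polys_upto k \<subseteq> mpoly.span (B :: 'd::finite mpoly set)"
proof (intro exI conjI subsetI)
  let ?B = "(\<lambda>is. prod_list (map indet is)) ` {is :: 'd list. length is \<le> nat k}"
  show "finite ?B" using finite_lists_length_le[of "UNIV :: 'd set" "nat k"] by simp
  fix p :: "'d mpoly" assume p: "p \<in> polys_upto k"
  have "p = (\<Sum>m\<in>Poly_Mapping.keys p. smult_poly (coeff_of p m) (Poly_Mapping.single m 1))"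
    using poly_eq_sum_monomials[of p] by (simp add: smult_poly_single)
  also have "\<dots> \<in> mpoly.span ?B"
  proof (intro mpoly.span_sum mpoly.span_scale mpoly.span_base)
    fix m assume "m \<in> Poly_Mapping.keys p"
    then have "int (monom_degree m) \<le> k" using p by (auto simp: polys_upto_def)
    then show "Poly_Mapping.single m 1 \<in> ?B"
    proof -
      obtain "is" where "length is = monom_degree m"
        "Poly_Mapping.single m (1::complex) = prod_list (map indet is)"
        using monomial_as_product_of_indets[of m] by blast
      then show ?thesis
        using \<open>int (monom_degree m) \<le> k\<close> by (intro image_eqI[of _ _ "is"]) auto
    qed
  qed
  finally show "p \<in> mpoly.span ?B" .
qed

text \<open>
  If two members coincide, their difference is the relation; otherwise the members form an infinite
  subset of a finite-dimensional space. Stating the relation for the family, not for its range,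
  provides the coefficients of a nonzero polynomial in one variable.
\<close>

lemma sequence_in_finite_span_dependent:
  fixes r :: "nat \<Rightarrow> 'd::finite mpoly"
  assumes B: "finite B" and r: "\<And>k. r k \<in> mpoly.span B"
  shows "\<exists>c K. (\<exists>i\<le>K. c i \<noteq> 0) \<and> (\<Sum>i\<le>K. smult_poly (c i) (r i)) = 0"
proof (cases "inj r")
  case True
  then have "infinite (range r)" using finite_imageD infinite_UNIV_nat by blast
  then have "mpoly.dependent (range r)"
    using mpoly.independent_span_bound[OF B, of "range r"] r by auto
  then obtain T u where T: "finite T" "T \<subseteq> range r" "(\<Sum>v\<in>T. smult_poly (u v) v) = 0"
    and "\<exists>v\<in>T. u v \<noteq> 0" unfolding mpoly.dependent_explicit by blast
  obtain J where J: "finite J" "T = r ` J" using T finite_subset_image by metis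
  have inj: "inj_on r J" using True by (rule inj_on_subset) auto
  define c where "c i = (if i \<in> J then u (r i) else 0)" for i
  have "(\<Sum>i\<le>Max J. smult_poly (c i) (r i)) = (\<Sum>i\<in>J. smult_poly (u (r i)) (r i))"
    using J(1) by (intro sum.mono_neutral_cong_right) (auto simp: c_def)
  also have "\<dots> = 0" using T(3) unfolding J(2) by (simp add: sum.reindex[OF inj])
  finally have "(\<Sum>i\<le>Max J. smult_poly (c i) (r i)) = 0" .
  moreover have "\<exists>i\<le>Max J. c i \<noteq> 0"
    using \<open>\<exists>v\<in>T. u v \<noteq> 0\<close> J by (auto simp: c_def)
  ultimately show ?thesis by blast
next
  case False
  then obtain a b where ab: "a < b" "r a = r b"
    unfolding inj_def by (metis linorder_neqE_nat)
  define c where "c i = (if i = b then 1 else if i = a then - 1 else 0 :: complex)" for i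
  have "(\<Sum>i\<le>b. smult_poly (c i) (r i)) = (\<Sum>i\<in>{a, b}. smult_poly (c i) (r i))"
    using ab by (intro sum.mono_neutral_right) (auto simp: c_def)
  also have "\<dots> = 0" using ab by (simp add: c_def)
  finally show ?thesis by (intro exI[of _ c] exI[of _ b]) (auto simp: c_def)
qed

context moment_decomposition
begin

text \<open>
  If all \<open>V n\<close> with \<open>n \<ge> N\<close> are null, dropping their components shows that every polynomial agrees
  almost everywhere with one of degree at most \<open>N\<close>. These lie in a finite-dimensional space, so the
  powers of a single coordinate satisfy a nontrivial linear relation almost everywhere, and the
  coordinate takes its values among the finitely many roots of that relation.
\<close>

lemma coordinate_finitely_valued:
  assumes null: "\<And>n p. n \<ge> N \<Longrightarrow> p \<in> V n \<Longrightarrow> vanishes p"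
  shows "\<exists>R. finite R \<and> (AE x in \<mu>. x $ j \<in> R)"
proof -
  have "\<exists>r\<in>polys_upto (int N). vanishes (p - r)" for p
  proof -
    obtain m where m: "p \<in> polys_upto (int m)" using poly_upto_exists_nat by blast
    let ?r = "\<Sum>k\<in>{..m} \<inter> {..<N}. P k p"
    have "p = (\<Sum>k\<in>{..m} - {..<N}. P k p) + ?r"
      using poly_eq_sum_proj(1)[OF m] sum.Int_Diff[of "{..m}" "\<lambda>k. P k p" "{..<N}"]
      by (simp add: add.commute)
    then have "p - ?r = (\<Sum>k\<in>{..m} - {..<N}. P k p)" unfolding diff_eq_eq .
    moreover have "(\<Sum>k\<in>{..m} - {..<N}. P k p) \<in> {p. vanishes p}"
      by (intro mpoly.subspace_sum subspace_vanishing CollectI null[OF _ proj_in]) simp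
    ultimately have "vanishes (p - ?r)" by simp
    moreover have "P k p \<in> polys_upto (int N)" if "k < N" for k
      using that proj_in[of k p] V_subset[of k] polys_upto_mono[of "int k" "int N"] by auto
    then have "?r \<in> polys_upto (int N)"
      by (intro mpoly.subspace_sum subspace_polys_upto) auto
    ultimately show ?thesis by blast
  qed
  then have "\<forall>k. \<exists>r. r \<in> polys_upto (int N) \<and>
      vanishes (Poly_Mapping.single (Poly_Mapping.single j k) 1 - r)" by blast
  then obtain r where r: "r k \<in> polys_upto (int N)"
      "vanishes (Poly_Mapping.single (Poly_Mapping.single j k) 1 - r k)" for k :: nat
    unfolding choice_iff by blast
  obtain B :: "'d mpoly set" where B: "finite B" "polys_upto (int N) \<subseteq> mpoly.span B"
    using polys_upto_finitely_spanned by blast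
  obtain c K where c: "\<exists>i\<le>K. c i \<noteq> 0" "(\<Sum>i\<le>K. smult_poly (c i) (r i)) = 0"
    using sequence_in_finite_span_dependent[OF B(1), of r] r(1) B(2) by blast
  let ?x = "\<lambda>k. Poly_Mapping.single (Poly_Mapping.single j k) 1 :: 'd mpoly"
  have "(\<Sum>i\<le>K. smult_poly (c i) (?x i - r i)) = (\<Sum>i\<le>K. smult_poly (c i) (?x i))"
    using c(2) by (simp add: mpoly.scale_right_diff_distrib sum_subtractf)
  moreover have "(\<Sum>i\<le>K. smult_poly (c i) (?x i - r i)) \<in> {p. vanishes p}"
    by (intro mpoly.subspace_sum mpoly.subspace_scale subspace_vanishing CollectI r(2))
  ultimately have "vanishes (\<Sum>i\<le>K. smult_poly (c i) (?x i))" by simp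
  then have AE: "AE x in \<mu>. (\<Sum>i\<le>K. c i * complex_of_real (x $ j) ^ i) = 0"
    unfolding vanishes_def by (simp add: eval_poly_sum eval_poly_single monom_value_single)
  let ?Z = "{z. (\<Sum>i\<le>K. c i * z ^ i) = 0}"
  have "finite ?Z" using c(1) by (simp add: polyfun_finite_roots)
  then have "finite (complex_of_real -` ?Z)"
    by (rule finite_vimageI) (rule inj_of_real)
  moreover have "AE x in \<mu>. x $ j \<in> complex_of_real -` ?Z" using AE by simp
  ultimately show ?thesis by blast
qed

text \<open>
  From left to right, almost every point has each coordinate in a finite set, so almost every point
  lies in a finite grid. From right to left, \<open>p \<in> V n\<close> agrees on the support with an interpolating
  polynomial of degree at most \<open>card F < n\<close>, to which it is orthogonal; hence \<open>p\<close> is orthogonal to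
  itself.
\<close>

lemma eventually_null_iff_finite_support:
  "(\<exists>N\<ge>1. \<forall>n\<ge>N. \<forall>p\<in>V n. vanishes p) \<longleftrightarrow> (\<exists>F. finite F \<and> (AE x in \<mu>. x \<in> F))"
proof
  assume "\<exists>N\<ge>1. \<forall>n\<ge>N. \<forall>p\<in>V n. vanishes p"
  then obtain N where N: "\<And>n p. n \<ge> N \<Longrightarrow> p \<in> V n \<Longrightarrow> vanishes p" by blast
  have "\<forall>j. \<exists>R. finite R \<and> (AE x in \<mu>. x $ j \<in> R)"
    by (intro allI coordinate_finitely_valued[OF N])
  then obtain R where R: "\<And>j. finite (R j)" "\<And>j. AE x in \<mu>. x $ j \<in> R j"
    unfolding choice_iff by blast
  let ?F = "(\<lambda>f. \<chi> j. f j) ` (\<Pi>\<^sub>E j\<in>UNIV. R j)"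
  have "finite ?F" using R(1) by (intro finite_imageI finite_PiE) auto
  moreover have "AE x in \<mu>. \<forall>j. x $ j \<in> R j"
    using R(2) by (simp add: AE_all_countable)
  then have "AE x in \<mu>. x \<in> ?F"
  proof (rule AE_mp, intro AE_I2 impI)
    fix x assume "\<forall>j. x $ j \<in> R j"
    then show "x \<in> ?F" by (intro image_eqI[of _ _ "\<lambda>j. x $ j"]) auto
  qed
  ultimately show "\<exists>F. finite F \<and> (AE x in \<mu>. x \<in> F)" by blast
next
  assume "\<exists>F. finite F \<and> (AE x in \<mu>. x \<in> F)"
  then obtain F where F: "finite F" "AE x in \<mu>. x \<in> F" by blast
  have "vanishes p" if n: "n \<ge> Suc (card F)" and p: "p \<in> V n" for n p
  proof -
    obtain r where r: "r \<in> polys_upto (int (card F))" "\<forall>x\<in>F. value_at r x = value_at p x"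
      using interpolation[OF F(1), of "value_at p"] by blast
    have "vanishes (p - r)"
      using F(2) r(2) unfolding vanishes_def by (elim AE_mp) (auto intro!: AE_I2)
    then have "poly_inner \<mu> p p = poly_inner \<mu> r p" by (rule poly_inner_cong_left)
    also have "\<dots> = poly_inner \<mu> (\<Sum>k\<le>card F. P k r) p"
      using poly_eq_sum_proj(1)[OF r(1)] by (rule arg_cong)
    also have "\<dots> = 0"
      unfolding poly_inner_sum_left
      using n by (intro sum.neutral ballI orthogonal[OF _ proj_in p]) auto
    finally show ?thesis by (simp add: poly_inner_self_eq_0_iff)
  qed
  then show "\<exists>N\<ge>1. \<forall>n\<ge>N. \<forall>p\<in>V n. vanishes p" by (intro exI[of _ "Suc (card F)"]) auto
qed

end

theorem theorem3p3:
  fixes \<mu> :: "(real ^ 'd) measure"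
    and V :: "nat \<Rightarrow> 'd mpoly set"
  assumes "prob_space \<mu>" and "sets \<mu> = sets borel"
    and "finite_moments \<mu>"
    and "orthogonal_decomposition \<mu> V"
  shows "(\<exists>n0\<ge>1. \<forall>n\<ge>n0. \<forall>\<xi>\<in>sym_tensors n. jacobi_op \<mu> V n \<xi> = 0) \<longleftrightarrow>
    (\<exists>(I :: nat set) (a :: nat \<Rightarrow> real) (x :: nat \<Rightarrow> real ^ 'd).
       finite I \<and> (\<forall>i\<in>I. a i > 0) \<and> (\<Sum>i\<in>I. a i) = 1 \<and>
       (\<forall>A\<in>sets borel. emeasure \<mu> A = (\<Sum>i\<in>I. ennreal (a i) * emeasure (return borel (x i)) A)))"
proof -
  interpret moment_decomposition \<mu> V
    using assms(3,4)
    by (intro moment_decomposition.intro monic_decomposition.intro moment_decomposition_axioms.intro)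
  show ?thesis
    unfolding jacobi_op_zero_iff eventually_null_iff_finite_support
    using assms(1,2) by (rule finitely_atomic_iff)
qed

end
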